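(* Let $\boldsymbol{G}$ be a linear quantum system with $n$ oscillators and $m=m_1+m_2$ input channels, with scattering matrix $S_G=\begin{bmatrix} S_{11} & S_{12} \\ S_{21} & S_{22} \end{bmatrix}$, coupling operators $\mathbf{L}_1=k_{11}\mathbf{a}+k_{12}\mathbf{a}^\#$ (for the first $m_1$ channels) and $\mathbf{L}_2=k_{21}\mathbf{a}+k_{22}\mathbf{a}^\#$ (for the other $m_2$ channels), with adjustable coupling strengths $k_{11},k_{12}\in\mathbf{C}^{m_1\times n}$, $k_{21},k_{22}\in\mathbf{C}^{m_2\times n}$, and Hamiltonian matrix $\Omega_G=\Delta(\Omega_-,\Omega_+)$. Form a coherent feedback network by sending the $m_2$ output channels of $\boldsymbol{G}$ through a beamsplitter with scattering matrix $S_b$, whose output is fed back into the $m_2$ input channels of $\boldsymbol{G}$. Let $\bar{\mathcal{C}}$ and $\bar\Omega$ be the overall coupling matrix and overall Hamiltonian matrix of the network (given in the context). If there exist complex coupling strength parameters $k_{ij}$, $i,j=1,2$, such that the overall coupling matrix $\bar{\mathcal{C}}$ is real or purely imaginary, and the overall Hamiltonian matrix $\bar\Omega$ is purely imaginary, then bilateral BAE measurements in the quantum coherent feedback network can be realized.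
   Context: $\imath=\sqrt{-1}$; $X^\#$ is the entrywise complex conjugate (adjoint, for operator entries), $X^\dagger=(X^\#)^\top$; $\Delta(U,V)=\begin{bmatrix} U & V \\ V^\# & U^\# \end{bmatrix}$; $J_k=\mathrm{diag}(I_k,-I_k)$; for $X\in\mathbf{C}^{2k\times 2r}$, $X^\flat=J_rX^\dagger J_k$; $V_k=\frac1{\sqrt2}\begin{bmatrix} I_k & I_k \\ -\imath I_k & \imath I_k \end{bmatrix}$. A matrix is purely imaginary if its real part is zero. Linear quantum system: a unitary scattering matrix $S\in\mathbf{C}^{m\times m}$; $C_\pm\in\mathbf{C}^{m\times n}$ with $\mathcal{C}=\Delta(C_-,C_+)$; Hermitian $\Omega=\Delta(\Omega_-,\Omega_+)\in\mathbf{C}^{2n\times2n}$; coupling operator $\mathbf{L}=C_-\mathbf{a}+C_+\mathbf{a}^\#$ and Hamiltonian $\mathbf{H}=\frac12\breve{\mathbf{a}}^\dagger\Omega\breve{\mathbf{a}}$, $\breve{\mathbf{a}}=\begin{bmatrix} \mathbf{a} \\ \mathbf{a}^\# \end{bmatrix}$, with $\mathbf{a}=(\mathbf{a}_1,\dots,\mathbf{a}_n)^\top$ the annihilation operators. Its real quadrature form is $\dot{\mathbf{x}}=\mathbb{A}\mathbf{x}+\mathbb{B}\mathbf{u}$, $\mathbf{y}=\mathbb{C}\mathbf{x}+\mathbb{D}\mathbf{u}$ with $\mathbf{x}=[\mathbf{q}^\top\ \mathbf{p}^\top]^\top$, $\mathbf{u}=[\mathbf{q}_{\rm in}^\top\ \mathbf{p}_{\rm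 in}^\top]^\top$, $\mathbf{y}=[\mathbf{q}_{\rm out}^\top\ \mathbf{p}_{\rm out}^\top]^\top$, where $\mathbb{D}=V_m\Delta(S,0)V_m^\dagger$, $\mathbb{C}=V_m\mathcal{C}V_n^\dagger$, $\mathbb{B}=-V_n\mathcal{C}^\flat\Delta(S,0)V_m^\dagger$, $\mathbb{A}=V_n\left(-\imath J_n\Omega-\frac12\mathcal{C}^\flat\mathcal{C}\right)V_n^\dagger$. The transfer matrix is $\mathbb{G}[s]=\mathbb{D}+\mathbb{C}(sI-\mathbb{A})^{-1}\mathbb{B}$, partitioned conformably with $\mathbf{u},\mathbf{y}$. A back-action-evading (BAE) measurement of an output quadrature with respect to an input quadrature is realized when the corresponding block of $\mathbb{G}[s]$ vanishes identically. Bilateral BAE measurements are realized if either both off-diagonal blocks $\mathbb{G}_{\mathbf{p}_{\rm in}\to\mathbf{q}_{\rm out}}$ and $\mathbb{G}_{\mathbf{q}_{\rm in}\to\mathbf{p}_{\rm out}}$ vanish, or both diagonal blocks $\mathbb{G}_{\mathbf{q}_{\rm in}\to\mathbf{q}_{\rm out}}$ and $\mathbb{G}_{\mathbf{p}_{\rm in}\to\mathbf{p}_{\rm out}}$ vanish. Coherent feedback network: it is reduced to an open linear quantum system with scattering matrix $$S^{\rm red}=S_{11}+S_{12}S_b(I-S_{22}S_b)^{-1}S_{21},$$ overall coupling matrix $\bar{\mathcal{C}}=\Delta(\bar C_-,\bar C_+)$ with $$\bar C_-=k_{11}+S_{12}S_b(I-S_{22}S_b)^{-1}k_{21},\qquad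 \bar C_+=k_{12}+S_{12}S_b(I-S_{22}S_b)^{-1}k_{22},$$ and overall Hamiltonian matrix $\bar\Omega=\Delta(\bar\Omega_-,\bar\Omega_+)$ with $$\bar\Omega_-=\Omega_--\imath(k_{11}^\dagger S_bk_{21}-k_{21}^\dagger S_b^\dagger k_{11}),\qquad \bar\Omega_+=\Omega_+-\imath(k_{11}^\dagger S_bk_{22}-k_{21}^\dagger S_b^\dagger k_{12}).$$ Here the inverse and all matrix products are understood to be defined.
   Formalization: Adds the hypothesis that the network's scattering matrix S^red is real or purely imaginary; without it the claim fails (S_G=diag(e^{iπ/4},1), S_b=-1, all k_ij=0, Ω_G=0), and bilateral BAE forces it. Takes m_1=m_2, as the products in the overall Hamiltonian require. *)

theory Defs
  imports "HOL-Analysis.Analysis"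
begin

text \<open>Block matrices are indexed by sum types. A scalar \<open>c\<close> acts on a matrix as \<open>mat c ** X\<close>.\<close>

definition cnj_mat :: "complex^'n^'m \<Rightarrow> complex^'n^'m" where
  "cnj_mat X = (\<chi> i j. cnj (X $ i $ j))"

definition dagger :: "complex^'n^'m \<Rightarrow> complex^'m^'n" where
  "dagger X = transpose (cnj_mat X)"

definition unitary_mat :: "complex^'n^'n \<Rightarrow> bool" where
  "unitary_mat U \<longleftrightarrow> dagger U ** U = mat 1 \<and> U ** dagger U = mat 1"

definition hermitian_mat :: "complex^'n^'n \<Rightarrow> bool" where
  "hermitian_mat H \<longleftrightarrow> dagger H = H"

definition real_mat :: "complex^'n^'m \<Rightarrow> bool" where
  "real_mat X \<longleftrightarrow> (\<forall>i j. Im (X $ i $ j) = 0)"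

definition imaginary_mat :: "complex^'n^'m \<Rightarrow> bool" where
  "imaginary_mat X \<longleftrightarrow> (\<forall>i j. Re (X $ i $ j) = 0)"

definition block_mat ::
  "complex^'n^'m \<Rightarrow> complex^'p^'m \<Rightarrow> complex^'n^'q \<Rightarrow> complex^'p^'q \<Rightarrow> complex^('n::finite + 'p::finite)^('m::finite + 'q::finite)"
  where
  "block_mat A B C D = (\<chi> i j.
     case i of
       Inl i' \<Rightarrow> (case j of Inl j' \<Rightarrow> A $ i' $ j' | Inr j' \<Rightarrow> B $ i' $ j')
     | Inr i' \<Rightarrow> (case j of Inl j' \<Rightarrow> C $ i' $ j' | Inr j' \<Rightarrow> D $ i' $ j'))"

definition stack_mat :: "complex^'n^'m \<Rightarrow> complex^'n^'q \<Rightarrow> complex^'n^('m::finite + 'q::finite)" where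
  "stack_mat A B = (\<chi> i. case i of Inl i' \<Rightarrow> A $ i' | Inr i' \<Rightarrow> B $ i')"

definition top_rows :: "complex^'n^('m::finite + 'q::finite) \<Rightarrow> complex^'n^'m" where
  "top_rows X = (\<chi> i. X $ Inl i)"

definition bottom_rows :: "complex^'n^('m::finite + 'q::finite) \<Rightarrow> complex^'n^'q" where
  "bottom_rows X = (\<chi> i. X $ Inr i)"

definition block11 :: "complex^('n::finite + 'p::finite)^('m::finite + 'q::finite) \<Rightarrow> complex^'n^'m" where
  "block11 X = (\<chi> i j. X $ Inl i $ Inl j)"

definition block12 :: "complex^('n::finite + 'p::finite)^('m::finite + 'q::finite) \<Rightarrow> complex^'p^'m" where
  "block12 X = (\<chi> i j. X $ Inl i $ Inr j)"

definition block21 :: "complex^('n::finite + 'p::finite)^('m::finite + 'q::finite) \<Rightarrow> complex^'n^'q" where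
  "block21 X = (\<chi> i j. X $ Inr i $ Inl j)"

definition block22 :: "complex^('n::finite + 'p::finite)^('m::finite + 'q::finite) \<Rightarrow> complex^'p^'q" where
  "block22 X = (\<chi> i j. X $ Inr i $ Inr j)"

definition Delta :: "complex^'n^'m \<Rightarrow> complex^'n^'m \<Rightarrow> complex^('n::finite + 'n::finite)^('m::finite + 'm::finite)" where
  "Delta U V = block_mat U V (cnj_mat V) (cnj_mat U)"

definition J_mat :: "complex^('k::finite + 'k::finite)^('k::finite + 'k::finite)" where
  "J_mat = block_mat (mat 1) 0 0 (mat (-1))"

definition flat :: "complex^('r::finite + 'r::finite)^('k::finite + 'k::finite) \<Rightarrow> complex^('k::finite + 'k::finite)^('r::finite + 'r::finite)" where
  "flat X = J_mat ** dagger X ** J_mat"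

definition V_mat :: "complex^('k::finite + 'k::finite)^('k::finite + 'k::finite)" where
  "V_mat = (1 / sqrt 2) *\<^sub>R block_mat (mat 1) (mat 1) (mat (-\<i>)) (mat \<i>)"

text \<open>A system with \<open>CARD('n)\<close> oscillators and \<open>CARD('m)\<close> channels is given by the parameters
  of its coupling operator \<open>L = C\<^sub>- a + C\<^sub>+ a\<^sup>#\<close> and of its quadratic Hamiltonian.\<close>

record ('n, 'm) lqs =
  scattering :: "complex^'m^'m"
  C_minus :: "complex^'n^'m"
  C_plus :: "complex^'n^'m"
  Omega_minus :: "complex^'n^'n"
  Omega_plus :: "complex^'n^'n"

definition coupling_matrix :: "('n::finite, 'm::finite) lqs \<Rightarrow> complex^('n::finite + 'n::finite)^('m::finite + 'm::finite)" where
  "coupling_matrix G = Delta (C_minus G) (C_plus G)"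

definition hamiltonian_matrix :: "('n::finite, 'm::finite) lqs \<Rightarrow> complex^('n::finite + 'n::finite)^('n::finite + 'n::finite)" where
  "hamiltonian_matrix G = Delta (Omega_minus G) (Omega_plus G)"

definition linear_quantum_system :: "('n::finite, 'm::finite) lqs \<Rightarrow> bool" where
  "linear_quantum_system G \<longleftrightarrow>
     unitary_mat (scattering G) \<and> hermitian_mat (hamiltonian_matrix G)"

definition quad_D :: "('n::finite, 'm::finite) lqs \<Rightarrow> complex^('m::finite + 'm::finite)^('m::finite + 'm::finite)" where
  "quad_D G = V_mat ** Delta (scattering G) 0 ** dagger V_mat"

definition quad_C :: "('n::finite, 'm::finite) lqs \<Rightarrow> complex^('n::finite + 'n::finite)^('m::finite + 'm::finite)" where
  "quad_C G = V_mat ** coupling_matrix G ** dagger V_mat"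

definition quad_B :: "('n::finite, 'm::finite) lqs \<Rightarrow> complex^('m::finite + 'm::finite)^('n::finite + 'n::finite)" where
  "quad_B G = - (V_mat ** flat (coupling_matrix G) ** Delta (scattering G) 0 ** dagger V_mat)"

definition quad_A :: "('n::finite, 'm::finite) lqs \<Rightarrow> complex^('n::finite + 'n::finite)^('n::finite + 'n::finite)" where
  "quad_A G = V_mat ** (mat (-\<i>) ** J_mat ** hamiltonian_matrix G
      - (1/2) *\<^sub>R (flat (coupling_matrix G) ** coupling_matrix G)) ** dagger V_mat"

text \<open>Meaningful only where \<open>mat s - quad_A G\<close> is invertible.\<close>

definition transfer_matrix ::
  "('n::finite, 'm::finite) lqs \<Rightarrow> complex \<Rightarrow> complex^('m::finite + 'm::finite)^('m::finite + 'm::finite)" where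
  "transfer_matrix G s = quad_D G + quad_C G ** matrix_inv (mat s - quad_A G) ** quad_B G"

text \<open>The columns of the transfer matrix are ordered as \<open>(q\<^sub>i\<^sub>n, p\<^sub>i\<^sub>n)\<close> and its rows as
  \<open>(q\<^sub>o\<^sub>u\<^sub>t, p\<^sub>o\<^sub>u\<^sub>t)\<close>. A block vanishes identically if it is zero at every \<open>s\<close> that is not an
  eigenvalue of \<open>quad_A G\<close>.\<close>

definition BAE_qin_qout :: "('n::finite, 'm::finite) lqs \<Rightarrow> bool" where
  "BAE_qin_qout G \<longleftrightarrow>
     (\<forall>s. invertible (mat s - quad_A G) \<longrightarrow> block11 (transfer_matrix G s) = 0)"

definition BAE_pin_qout :: "('n::finite, 'm::finite) lqs \<Rightarrow> bool" where
  "BAE_pin_qout G \<longleftrightarrow>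
     (\<forall>s. invertible (mat s - quad_A G) \<longrightarrow> block12 (transfer_matrix G s) = 0)"

definition BAE_qin_pout :: "('n::finite, 'm::finite) lqs \<Rightarrow> bool" where
  "BAE_qin_pout G \<longleftrightarrow>
     (\<forall>s. invertible (mat s - quad_A G) \<longrightarrow> block21 (transfer_matrix G s) = 0)"

definition BAE_pin_pout :: "('n::finite, 'm::finite) lqs \<Rightarrow> bool" where
  "BAE_pin_pout G \<longleftrightarrow>
     (\<forall>s. invertible (mat s - quad_A G) \<longrightarrow> block22 (transfer_matrix G s) = 0)"

definition bilateral_BAE :: "('n::finite, 'm::finite) lqs \<Rightarrow> bool" where
  "bilateral_BAE G \<longleftrightarrow>
     (BAE_pin_qout G \<and> BAE_qin_pout G) \<or> (BAE_qin_qout G \<and> BAE_pin_pout G)"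

text \<open>The second group of channels of \<open>G\<close> is fed back through a beamsplitter with scattering
  matrix \<open>Sb\<close>. The product of \<open>dagger k11\<close> with \<open>Sb\<close> in the network Hamiltonian is defined only
  if both groups have the same number of channels, hence the channel type \<open>'m + 'm\<close>. The
  formulas presuppose that \<open>mat 1 - S22 ** Sb\<close> is invertible.\<close>

definition feedback_network ::
  "('n::finite, 'm::finite + 'm::finite) lqs \<Rightarrow> complex^'m^'m \<Rightarrow> ('n, 'm) lqs" where
  "feedback_network G Sb = (let
     S11 = block11 (scattering G); S12 = block12 (scattering G);
     S21 = block21 (scattering G); S22 = block22 (scattering G);
     k11 = top_rows (C_minus G); k12 = top_rows (C_plus G);
     k21 = bottom_rows (C_minus G); k22 = bottom_rows (C_plus G);
     F = S12 ** Sb ** matrix_inv (mat 1 - S22 ** Sb)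
   in \<lparr> scattering = S11 + F ** S21,
        C_minus = k11 + F ** k21,
        C_plus = k12 + F ** k22,
        Omega_minus = Omega_minus G
          - mat \<i> ** (dagger k11 ** Sb ** k21 - dagger k21 ** dagger Sb ** k11),
        Omega_plus = Omega_plus G
          - mat \<i> ** (dagger k11 ** Sb ** k22 - dagger k21 ** dagger Sb ** k12) \<rparr>)"

end

theory Submission
  imports Defs
begin

text \<open>The swap \<open>\<Sigma>\<close> of the two block coordinates satisfies \<open>\<Sigma> X \<Sigma> = X\<^sup>#\<close> for every doubled-up matrix
  \<open>X = \<Delta>(U, V)\<close>, so a real \<open>X\<close> commutes with \<open>\<Sigma>\<close> and a purely imaginary one anticommutes with it.
  The change to quadratures carries \<open>\<Sigma>\<close> to \<open>J\<close>, as \<open>J V = V \<Sigma>\<close>. Hence the commutation sign with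
  \<open>J\<close> is \<open>1\<close> for \<open>quad_A\<close>: a purely imaginary Hamiltonian contributes \<open>-1\<close>, the factor \<open>J\<close> in \<open>-\<i>J\<Omega>\<close>
  another \<open>-1\<close>, and the coupling enters twice. It follows that the transfer matrix has the
  sign of the scattering matrix. A matrix commuting with \<open>J\<close> is block diagonal, and one anticommuting with
  \<open>J\<close> is block off-diagonal.\<close>

section \<open>Block, adjoint and sign calculus for complex matrices\<close>

lemma sum_over_sum_type:
  fixes f :: "'a::finite + 'b::finite \<Rightarrow> 'c::comm_monoid_add"
  shows "(\<Sum>k\<in>UNIV. f k) = (\<Sum>k\<in>UNIV. f (Inl k)) + (\<Sum>k\<in>UNIV. f (Inr k))"
  unfolding UNIV_Plus_UNIV[symmetric] by (simp add: sum.Plus del: UNIV_Plus_UNIV)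

lemma block_mat_mult:
  "block_mat A B C D ** block_mat E F G H =
   block_mat (A ** E + B ** G) (A ** F + B ** H) (C ** E + D ** G) (C ** F + D ** H)"
  by (auto simp: vec_eq_iff matrix_matrix_mult_def block_mat_def sum_over_sum_type split: sum.split)

lemma block_mat_eq_iff:
  "block_mat A B C D = block_mat E F G H \<longleftrightarrow> A = E \<and> B = F \<and> C = G \<and> D = H"
  by (auto simp: vec_eq_iff block_mat_def split_sum_all)

lemma block_mat_blocks: "block_mat (block11 X) (block12 X) (block21 X) (block22 X) = X"
  by (auto simp: vec_eq_iff block_mat_def block11_def block12_def block21_def block22_def
      split: sum.split)

lemma scaleR_block_mat:
  "c *\<^sub>R block_mat A B C D = block_mat (c *\<^sub>R A) (c *\<^sub>R B) (c *\<^sub>R C) (c *\<^sub>R D)"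
  by (auto simp: vec_eq_iff block_mat_def split: sum.split)

lemma dagger_block_mat:
  "dagger (block_mat A B C D) = block_mat (dagger A) (dagger C) (dagger B) (dagger D)"
  by (auto simp: vec_eq_iff block_mat_def dagger_def transpose_def cnj_mat_def split: sum.split)

lemma dagger_mult: "dagger (X ** Y) = dagger Y ** dagger X"
  by (simp add: dagger_def vec_eq_iff transpose_def cnj_mat_def matrix_matrix_mult_def mult.commute)

lemma dagger_scaleR: "dagger (c *\<^sub>R X) = c *\<^sub>R dagger X"
  by (simp add: dagger_def vec_eq_iff transpose_def cnj_mat_def)

lemma dagger_mat: "dagger (mat c) = mat (cnj c)"
  by (auto simp: dagger_def vec_eq_iff transpose_def cnj_mat_def mat_def)

lemma dagger_zero: "dagger 0 = 0"
  by (simp add: dagger_def vec_eq_iff transpose_def cnj_mat_def)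

lemma scaleR_mult_left: "(c *\<^sub>R X) ** Y = c *\<^sub>R (X ** Y)" for X :: "complex^'n^'m"
  by (simp add: vec_eq_iff matrix_matrix_mult_def scaleR_sum_right)

lemma scaleR_mult_right: "X ** (c *\<^sub>R Y) = c *\<^sub>R (X ** Y)" for X :: "complex^'n^'m"
  by (simp add: vec_eq_iff matrix_matrix_mult_def scaleR_sum_right)

lemma mult_minus_left: "(- X) ** Y = - (X ** Y)" for X :: "complex^'n^'m"
  by (simp add: vec_eq_iff matrix_matrix_mult_def sum_negf)

lemma mult_minus_right: "X ** (- Y) = - (X ** Y)" for X :: "complex^'n^'m"
  by (simp add: vec_eq_iff matrix_matrix_mult_def sum_negf)

lemma mult_add_left: "(X + Y) ** Z = X ** Z + Y ** Z" for X :: "complex^'n^'m"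
  by (simp add: vec_eq_iff matrix_matrix_mult_def distrib_right sum.distrib)

lemma mat_minus: "mat (- c) = - mat c" for c :: complex
  by (simp add: vec_eq_iff mat_def)

lemma mat_mult_nth: "(mat c ** X) $ i $ j = c * X $ i $ j" for X :: "complex^'n^'m"
  by (simp add: mat_def matrix_matrix_mult_def if_distrib[where f = "\<lambda>x. x * _"] cong: if_cong)

lemma mult_mat_nth: "(X ** mat c) $ i $ j = X $ i $ j * c" for X :: "complex^'n^'m"
  by (simp add: mat_def matrix_matrix_mult_def if_distrib[where f = "\<lambda>x. _ * x"] cong: if_cong)

section \<open>Commutation up to a sign\<close>

text \<open>\<open>P\<close> and \<open>Q\<close> may differ, and even have different sizes, so that
  \<open>V_mat\<close>, which turns the swap into \<open>J_mat\<close>, and the rectangular coupling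
  matrices are covered too. The factor \<open>e\<close> multiplies along products.\<close>

definition intertwines ::
  "real \<Rightarrow> complex^'m^'m \<Rightarrow> complex^'n^'n \<Rightarrow> complex^'n^'m \<Rightarrow> bool" where
  "intertwines e P Q X \<longleftrightarrow> P ** X = e *\<^sub>R (X ** Q)"

lemma intertwines_mult:
  assumes "intertwines e P Q X" "intertwines f Q R Y"
  shows "intertwines (e * f) P R (X ** Y)"
proof -
  have "P ** (X ** Y) = e *\<^sub>R (X ** (Q ** Y))"
    using assms(1) by (simp add: intertwines_def matrix_mul_assoc scaleR_mult_left)
  also have "\<dots> = (e * f) *\<^sub>R ((X ** Y) ** R)"
    using assms(2) by (simp add: intertwines_def matrix_mul_assoc scaleR_mult_right)
  finally show ?thesis
    by (simp add: intertwines_def)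
qed

lemma intertwines_add:
  "intertwines e P Q X \<Longrightarrow> intertwines e P Q Y \<Longrightarrow> intertwines e P Q (X + Y)"
  by (simp add: intertwines_def matrix_add_ldistrib mult_add_left scaleR_add_right)

lemma intertwines_scaleR: "intertwines e P Q X \<Longrightarrow> intertwines e P Q (c *\<^sub>R X)"
  by (simp add: intertwines_def scaleR_mult_left scaleR_mult_right)

lemma intertwines_minus: "intertwines e P Q X \<Longrightarrow> intertwines e P Q (- X)"
  using intertwines_scaleR[of e P Q X "-1"] by simp

lemma intertwines_diff:
  "intertwines e P Q X \<Longrightarrow> intertwines e P Q Y \<Longrightarrow> intertwines e P Q (X - Y)"
  using intertwines_add[OF _ intertwines_minus, of e P Q X Y] by simp

lemma intertwines_mat: "intertwines 1 P P (mat c)"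
  by (simp add: intertwines_def vec_eq_iff mat_mult_nth mult_mat_nth)

text \<open>The adjoint exchanges the two sides, so the sign ends up on the other side of the
  equation; \<open>e * e = 1\<close> brings it back.\<close>

lemma intertwines_dagger:
  assumes "intertwines e P Q X" "dagger P = P" "dagger Q = Q" "e * e = 1"
  shows "intertwines e Q P (dagger X)"
proof -
  have "dagger X ** P = dagger (P ** X)"
    by (simp add: dagger_mult assms(2))
  also have "\<dots> = e *\<^sub>R (Q ** dagger X)"
    using assms(1) by (simp add: intertwines_def dagger_scaleR dagger_mult assms(3))
  finally show ?thesis
    using assms(4) by (simp add: intertwines_def)
qed

text \<open>Multiply \<open>P ** M = M ** Q\<close> by the inverse on both sides. Sign 1 is the case
  of the resolvent of \<open>quad_A\<close>.\<close>

lemma intertwines_matrix_inv: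
  assumes "intertwines 1 P Q M" "invertible M"
  shows "intertwines 1 Q P (matrix_inv M)"
proof -
  let ?N = "matrix_inv M"
  \<comment> \<open>\<open>matrix_inv\<close> is a Hilbert choice, so both equations come from the
    witness that invertibility provides.\<close>
  have N: "M ** ?N = mat 1" "?N ** M = mat 1"
    using assms(2)
    unfolding matrix_inv_def by (metis (mono_tags, lifting) invertible_def someI_ex)+
  have "Q ** ?N = ?N ** (M ** Q) ** ?N"
    by (simp add: matrix_mul_assoc N)
  also have "M ** Q = P ** M"
    using assms(1) by (simp add: intertwines_def)
  also have "?N ** (P ** M) ** ?N = ?N ** P ** (M ** ?N)"
    by (simp add: matrix_mul_assoc)
  finally show ?thesis
    by (simp add: intertwines_def N)
qed

section \<open>The swap, \<open>J_mat\<close> and the change to quadratures\<close>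

definition swap_mat :: "complex^('k::finite + 'k)^('k + 'k)" where
  "swap_mat = block_mat 0 (mat 1) (mat 1) 0"

lemma dagger_swap_mat: "dagger swap_mat = swap_mat"
  by (simp add: swap_mat_def dagger_block_mat dagger_mat dagger_zero)

lemma dagger_J_mat: "dagger J_mat = J_mat"
  by (simp add: J_mat_def dagger_block_mat dagger_mat dagger_zero)

lemma intertwines_J_mat: "intertwines (-1) swap_mat swap_mat J_mat"
  by (simp add: intertwines_def swap_mat_def J_mat_def block_mat_mult scaleR_block_mat
      block_mat_eq_iff mat_minus mult_minus_left mult_minus_right)

lemma intertwines_V_mat: "intertwines 1 J_mat swap_mat V_mat"
  by (simp add: intertwines_def swap_mat_def J_mat_def V_mat_def scaleR_mult_left
      scaleR_mult_right block_mat_mult mat_minus mult_minus_left mult_minus_right)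

lemma intertwines_dagger_V_mat: "intertwines 1 swap_mat J_mat (dagger V_mat)"
  by (rule intertwines_dagger[OF intertwines_V_mat dagger_J_mat dagger_swap_mat]) simp

lemma intertwines_quadrature:
  assumes "intertwines e swap_mat swap_mat X"
  shows "intertwines e J_mat J_mat (V_mat ** X ** dagger V_mat)"
  using intertwines_mult[OF intertwines_mult[OF intertwines_V_mat assms] intertwines_dagger_V_mat]
  by simp

text \<open>The two outer factors \<open>J_mat\<close> contribute -1 each, and the adjoint keeps
  \<open>e\<close>.\<close>

lemma intertwines_flat:
  assumes "intertwines e swap_mat swap_mat X" "e * e = 1"
  shows "intertwines e swap_mat swap_mat (flat X)"
  using intertwines_mult[OF intertwines_mult[OF intertwines_J_mat
        intertwines_dagger[OF assms(1) dagger_swap_mat dagger_swap_mat assms(2)]]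
      intertwines_J_mat]
  by (simp add: flat_def)

lemma real_Delta_cnj:
  assumes "real_mat (Delta U V)"
  shows "cnj_mat U = U" "cnj_mat V = V"
proof -
  have "Im (Delta U V $ Inl i $ Inl j) = 0" "Im (Delta U V $ Inl i $ Inr j) = 0" for i j
    using assms by (simp_all only: real_mat_def)
  then show "cnj_mat U = U" "cnj_mat V = V"
    by (simp_all add: Delta_def block_mat_def cnj_mat_def vec_eq_iff complex_eq_iff)
qed

lemma imaginary_Delta_cnj:
  assumes "imaginary_mat (Delta U V)"
  shows "cnj_mat U = - U" "cnj_mat V = - V"
proof -
  have "Re (Delta U V $ Inl i $ Inl j) = 0" "Re (Delta U V $ Inl i $ Inr j) = 0" for i j
    using assms by (simp_all only: imaginary_mat_def)
  then show "cnj_mat U = - U" "cnj_mat V = - V"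
    by (simp_all add: Delta_def block_mat_def cnj_mat_def vec_eq_iff complex_eq_iff)
qed

lemma intertwines_real_Delta:
  "real_mat (Delta U V) \<Longrightarrow> intertwines 1 swap_mat swap_mat (Delta U V)"
  by (frule real_Delta_cnj(1), drule real_Delta_cnj(2))
    (simp add: intertwines_def swap_mat_def Delta_def block_mat_mult)

lemma intertwines_imaginary_Delta:
  "imaginary_mat (Delta U V) \<Longrightarrow> intertwines (-1) swap_mat swap_mat (Delta U V)"
  by (frule imaginary_Delta_cnj(1), drule imaginary_Delta_cnj(2))
    (simp add: intertwines_def swap_mat_def Delta_def block_mat_mult scaleR_block_mat)

section \<open>Reading vanishing blocks off the sign\<close>

lemma J_mat_mult:
  "J_mat ** X = block_mat (block11 X) (block12 X) (- block21 X) (- block22 X)"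
  by (subst block_mat_blocks[of X, symmetric])
    (simp add: J_mat_def block_mat_mult mat_minus mult_minus_left mult_minus_right)

lemma mult_J_mat:
  "X ** J_mat = block_mat (block11 X) (- block12 X) (block21 X) (- block22 X)"
  by (subst block_mat_blocks[of X, symmetric])
    (simp add: J_mat_def block_mat_mult mat_minus mult_minus_left mult_minus_right)

text \<open>For blocks that equal their own negative. The product here is entrywise, not
  \<open>**\<close>.\<close>

lemma double_mat_eq_0: "2 * X = 0 \<longleftrightarrow> X = 0" for X :: "complex^'n^'m"
  by (simp add: vec_eq_iff)

text \<open>\<open>J_mat\<close> negates the lower blocks from the left and the right-hand blocks
  from the right, so each off-diagonal block equals its negative.\<close>

lemma commute_J_blocks:
  assumes "intertwines 1 J_mat J_mat X"
  shows "block12 X = 0" "block21 X = 0"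
  using assms
  by (auto simp: intertwines_def J_mat_mult mult_J_mat block_mat_eq_iff double_mat_eq_0)

lemma anticommute_J_blocks:
  assumes "intertwines (-1) J_mat J_mat X"
  shows "block11 X = 0" "block22 X = 0"
  using assms
  by (auto simp: intertwines_def J_mat_mult mult_J_mat scaleR_block_mat block_mat_eq_iff
      double_mat_eq_0)

section \<open>The sign of the transfer matrix\<close>

lemma intertwines_transfer_matrix:
  assumes S: "intertwines e swap_mat swap_mat (Delta (scattering G) 0)"
    and C: "intertwines f swap_mat swap_mat (coupling_matrix G)" and f: "f * f = 1"
    and H: "intertwines (-1) swap_mat swap_mat (hamiltonian_matrix G)"
    and inv: "invertible (mat s - quad_A G)"
  shows "intertwines e J_mat J_mat (transfer_matrix G s)"
proof -
  note Cf = intertwines_flat[OF C f]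
  have D: "intertwines e J_mat J_mat (quad_D G)"
    unfolding quad_D_def by (rule intertwines_quadrature[OF S])
  have C': "intertwines f J_mat J_mat (quad_C G)"
    unfolding quad_C_def by (rule intertwines_quadrature[OF C])
  \<comment> \<open>The brackets make the inner product a single factor between \<open>V_mat\<close>
    and its adjoint.\<close>
  have "intertwines (f * e) J_mat J_mat
      (V_mat ** (flat (coupling_matrix G) ** Delta (scattering G) 0) ** dagger V_mat)"
    by (rule intertwines_quadrature[OF intertwines_mult[OF Cf S]])
  then have B: "intertwines (f * e) J_mat J_mat (quad_B G)"
    unfolding quad_B_def by (intro intertwines_minus) (simp add: matrix_mul_assoc)
  \<comment> \<open>Multiplying by the scalar \<open>-\<i>\<close> would exchange real and imaginary
    entries, but it leaves the commutation sign alone; only \<open>J_mat\<close> and the Hamiltonian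
    count.\<close>
  have "intertwines 1 swap_mat swap_mat (mat (-\<i>) ** J_mat ** hamiltonian_matrix G)"
    using intertwines_mult[OF intertwines_mult[OF intertwines_mat intertwines_J_mat] H] by simp
  moreover have "intertwines 1 swap_mat swap_mat (flat (coupling_matrix G) ** coupling_matrix G)"
    using intertwines_mult[OF Cf C] f by simp
  ultimately have "intertwines 1 J_mat J_mat (quad_A G)"
    unfolding quad_A_def
    by (intro intertwines_quadrature intertwines_diff intertwines_scaleR)
  then have "intertwines 1 J_mat J_mat (matrix_inv (mat s - quad_A G))"
    by (intro intertwines_matrix_inv[OF intertwines_diff[OF intertwines_mat] inv])
  \<comment> \<open>The total sign is \<open>f * 1 * (f * e)\<close>, which equals \<open>e\<close>,
    the sign of \<open>quad_D\<close>.\<close>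
  from intertwines_mult[OF intertwines_mult[OF C' this] B]
  have "intertwines e J_mat J_mat (quad_C G ** matrix_inv (mat s - quad_A G) ** quad_B G)"
    using f by (simp flip: mult.assoc)
  with D show ?thesis
    unfolding transfer_matrix_def by (rule intertwines_add)
qed

lemma real_Delta_zero: "real_mat U \<Longrightarrow> real_mat (Delta U 0)"
  by (auto simp: real_mat_def Delta_def block_mat_def cnj_mat_def split: sum.split)

lemma imaginary_Delta_zero: "imaginary_mat U \<Longrightarrow> imaginary_mat (Delta U 0)"
  by (auto simp: imaginary_mat_def Delta_def block_mat_def cnj_mat_def split: sum.split)

text \<open>The sign \<open>f\<close> of the coupling cancels, so the scattering matrix alone
  selects the alternative: real entries kill the off-diagonal blocks, imaginary ones the diagonal
  blocks.\<close>

lemma bilateral_BAE_real_imaginary: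
  assumes S: "real_mat (scattering G) \<or> imaginary_mat (scattering G)"
    and C: "real_mat (coupling_matrix G) \<or> imaginary_mat (coupling_matrix G)"
    and H: "imaginary_mat (hamiltonian_matrix G)"
  shows "bilateral_BAE G"
proof -
  obtain f where f: "f * f = 1" "intertwines f swap_mat swap_mat (coupling_matrix G)"
  proof (cases "real_mat (coupling_matrix G)")
    case True
    then show ?thesis
      using that[of 1] by (simp add: coupling_matrix_def intertwines_real_Delta)
  next
    case False
    with C show ?thesis
      using that[of "-1"] by (simp add: coupling_matrix_def intertwines_imaginary_Delta)
  qed
  have H': "intertwines (-1) swap_mat swap_mat (hamiltonian_matrix G)"
    using H by (simp add: hamiltonian_matrix_def intertwines_imaginary_Delta)
  note transfer = intertwines_transfer_matrix[OF _ f(2,1) H']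
  from S show ?thesis
  proof
    assume "real_mat (scattering G)"
    from commute_J_blocks[OF transfer[OF intertwines_real_Delta[OF real_Delta_zero[OF this]]]]
    show ?thesis
      by (simp add: bilateral_BAE_def BAE_pin_qout_def BAE_qin_pout_def)
  next
    assume "imaginary_mat (scattering G)"
    from anticommute_J_blocks[OF
        transfer[OF intertwines_imaginary_Delta[OF imaginary_Delta_zero[OF this]]]]
    show ?thesis
      by (simp add: bilateral_BAE_def BAE_qin_qout_def BAE_pin_pout_def)
  qed
qed

text \<open>The coupling strengths do not enter the reduced scattering matrix, so its being real or
  imaginary is a separate condition. For large \<open>s\<close> the transfer matrix tends to
  \<open>quad_D\<close>, whose diagonal blocks are the real part of that matrix and whose
  off-diagonal blocks are its imaginary part up to sign; bilateral BAE therefore forces this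
  condition.\<close>

theorem theorem6:
  fixes S11 S12 S21 S22 Sb :: "complex^'m^'m"
    and k11 k12 k21 k22 :: "complex^'n^'m"
    and Om_minus Om_plus :: "complex^'n^'n"
    and G :: "('n, 'm + 'm) lqs"
    and N :: "('n, 'm) lqs"
  assumes G: "G = \<lparr> scattering = block_mat S11 S12 S21 S22,
                    C_minus = stack_mat k11 k21, C_plus = stack_mat k12 k22,
                    Omega_minus = Om_minus, Omega_plus = Om_plus \<rparr>"
    and "linear_quantum_system G"
    and "unitary_mat Sb"
    and "invertible (mat 1 - S22 ** Sb)"
    and N: "N = feedback_network G Sb"
    and "real_mat (scattering N) \<or> imaginary_mat (scattering N)"
    and "real_mat (coupling_matrix N) \<or> imaginary_mat (coupling_matrix N)"
    and "imaginary_mat (hamiltonian_matrix N)"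
  shows "bilateral_BAE N"
  using assms(6-8) by (rule bilateral_BAE_real_imaginary)

end
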